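(* Let $(SDP)$ be the "Shor's plus RLT plus Triangle" semidefinite relaxation of $(P)$, and let $(OPT)$ be the problem $$(OPT)\qquad \max_{S_0,\ldots,S_m\succeq 0}\ v(P'_{S_0,\ldots,S_m}),$$ where $v(\cdot)$ denotes the optimal value of a problem and $(P'_{S_0,\ldots,S_m})$ is the strengthened quadratic convex relaxation of $(P)$ (both defined in the context). Then $$v(OPT)=v(SDP).$$
   Context: Data: integers $n\ge 1$, $m\ge 0$; symmetric matrices $Q_0,\dots,Q_m\in\mathbb{R}^{n\times n}$; $c_0,\dots,c_m\in\mathbb{R}^n$; $b\in\mathbb{R}^m$; bounds $\ell,u\in\mathbb{R}^n$ with $0\le\ell_p\le u_p$. $\langle A,B\rangle=\sum_{p,q}a_{pq}b_{pq}$; $M\succeq0$ means $M$ symmetric positive semidefinite. $(P)$: minimize $\langle Q_0,xx^T\rangle+c_0^Tx$ over $x\in\mathbb{R}^n$ subject to $\langle Q_r,xx^T\rangle+c_r^Tx\le b_r$ ($r=1,\dots,m$) and $\ell_i\le x_i\le u_i$ ($i=1,\dots,n$). The feasible domain of $(P)$ is assumed non-empty. Optimal values are understood as infima (for minimization) and suprema (for maximization). McCormick functions, for $1\le i\le j\le n$: $h^1_{ij}(x,Y)=Y_{ij}-u_jx_i-\ell_ix_j+u_j\ell_i$, $h^2_{ij}(x,Y)=Y_{ij}-u_ix_j-\ell_jx_i+u_i\ell_j$, $h^3_{ij}(x,Y)=-Y_{ij}+u_jx_i+u_ix_j-u_iu_j$, $h^4_{ij}(x,Y)=-Y_{ij}+\ell_jx_i+\ell_ix_j-\ell_i\ell_j$.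 General triangle functions $h^{'t}_{ijk}(x,Y)$, for $1\le i<j<k\le n$: $t=1$: $(\ell_k -u_k)Y_{ij} + (\ell_j - u_j)Y_{ik} - u_i Y_{jk}+ u_iu_kx_j + (u_ju_k - \ell_j\ell_k)x_i + u_iu_jx_k - u_iu_ju_k$ $t=2$: $(\ell_k -u_k)Y_{ij} - u_jY_{ik}+ ( \ell_i -u_i)Y_{jk} + (u_iu_k - \ell_i\ell_k)x_j + u_ju_kx_i + u_iu_jx_k - u_iu_ju_k$ $t=3$: $- u_kY_{ij} + (\ell_j - u_j)Y_{ik}+ ( \ell_i -u_i)Y_{jk} + u_iu_kx_j + u_ju_kx_i + ( u_iu_j - \ell_i\ell_j)x_k - u_iu_ju_k$ $t=4$: $(u_j - \ell_j) Y_{ik} + (\ell_k - u_k) Y_{ij} + u_iY_{jk}+ (\ell_ju_k -u_j\ell_k)x_i - u_i\ell_kx_j - u_iu_jx_k + u_iu_j\ell_k$ $t=5$: $u_j Y_{ik} + (\ell_k - u_k) Y_{ij} + (u_i-\ell_i)Y_{jk} -u_j\ell_kx_i + (\ell_iu_k - u_i\ell_k)x_j - u_iu_jx_k + u_iu_j\ell_k$ $t=6$: $(u_k - \ell_k) Y_{ij} + u_iY_{jk} + (\ell_j - u_j) Y_{ik} -u_iu_kx_j +(u_j\ell_k - \ell_ju_k)x_i - u_i\ell_jx_k + u_i\ell_ju_k$ $t=7$: $u_kY_{ij} + (u_i - \ell_i) Y_{jk} + (\ell_j - u_j) Y_{ik} -u_iu_kx_j - \ell_ju_kx_i +(\ell_iu_j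 - u_i\ell_j)x_k + u_i\ell_ju_k$ $t=8$: $(u_k - \ell_k)Y_{ij} + (\ell_i - u_i) Y_{jk} + u_jY_{ik} +(u_i\ell_k - \ell_iu_k)x_j - u_ju_kx_i - \ell_iu_jx_k + \ell_iu_ju_k$ $t=9$: $u_kY_{ij} + (\ell_i - u_i) Y_{jk} + (u_j - \ell_j)Y_{ik} - \ell_iu_kx_j - u_ju_kx_i + (u_i\ell_j - \ell_iu_j) x_k + \ell_iu_ju_k$ $t=10$: $- u_i Y_{jk} + (u_j - \ell_j)Y_{ik} + (u_k - \ell_k) Y_{ij} + u_i\ell_kx_j + (\ell_j\ell_k - u_ju_k)x_i + u_i\ell_jx_k - u_i\ell_j\ell_k$ $t=11$: $(u_i - \ell_i)Y_{jk} - u_jY_{ik} + (u_k -\ell_k) Y_{ij} + (\ell_i\ell_k - u_iu_k)x_j + u_j\ell_kx_i + \ell_iu_jx_k - \ell_iu_j\ell_k$ $t=12$: $- u_kY_{ij} + (u_i - \ell_i)Y_{jk} + (u_j - \ell_j)Y_{ik} + \ell_iu_kx_j + \ell_ju_kx_i + (\ell_i\ell_j - u_iu_j)x_k - \ell_i\ell_ju_k$ $(P'_{S_0,\ldots,S_m})$, for $S_0,\dots,S_m\succeq0$ of size $n\times n$: minimize $\langle S_0,xx^T\rangle+c_0^Tx+\langle Q_0-S_0,Y\rangle$ over $x\in\mathbb{R}^n$ and $Y\in\mathbb{R}^{n\times n}$ subject to $\ell_i\le x_i\le u_i$ for all $i$; $Y_{ji}=Y_{ij}$ for $i<j$; $\langle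 S_r,xx^T\rangle+c_r^Tx+\langle Q_r-S_r,Y\rangle\le b_r$ for $r=1,\dots,m$; $h^t_{ij}(x,Y)\le0$ for all $1\le i\le j\le n$, $t=1,\dots,4$; $h^{'t}_{ijk}(x,Y)\le0$ for all $i<j<k$, $t=1,\dots,12$. $(SDP)$: minimize $\langle Q_0,X\rangle+c_0^Tx$ over $x\in\mathbb{R}^n$ and symmetric $X\in\mathbb{R}^{n\times n}$ subject to $\langle Q_r,X\rangle+c_r^Tx\le b_r$ ($r=1,\dots,m$); $X_{ii}-u_ix_i-\ell_ix_i+u_i\ell_i\le0$, $-X_{ii}+2u_ix_i-u_i^2\le0$, $-X_{ii}+2\ell_ix_i-\ell_i^2\le0$ ($i=1,\dots,n$); $h^t_{ij}(x,X)\le0$ for all $1\le i<j\le n$, $t=1,\dots,4$; $h^{'t}_{ijk}(x,X)\le0$ for all $i<j<k$, $t=1,\dots,12$; $\begin{pmatrix} 1 & x^T \\ x & X \end{pmatrix}\succeq0$. *)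

theory Defs
  imports "HOL-Analysis.Analysis"
begin

type_synonym 'n rvec = "(real, 'n) vec"
type_synonym 'n rmat = "((real, 'n) vec, 'n) vec"

definition psd :: "real^'k^'k \<Rightarrow> bool" where
  "psd M \<longleftrightarrow> transpose M = M \<and> (\<forall>v. 0 \<le> v \<bullet> (M *v v))"

definition outer :: "real^'n \<Rightarrow> real^'n^'n" where
  "outer x = (\<chi> i j. x $ i * x $ j)"

(* The bordered matrix [[1, x^T], [x, X]]; None indexes the additional first row and column. *)
definition bordered :: "real^'n \<Rightarrow> real^'n^'n \<Rightarrow> real^('n option)^('n option)" where
  "bordered x X = (\<chi> p q. case p of
       None \<Rightarrow> (case q of None \<Rightarrow> 1 | Some j \<Rightarrow> x $ j)
     | Some i \<Rightarrow> (case q of None \<Rightarrow> x $ i | Some j \<Rightarrow> X $ i $ j))"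

(* Optimal values are extended reals: the minimum over an empty feasible set is \<infinity>. *)
definition min_value :: "('a \<Rightarrow> real) \<Rightarrow> 'a set \<Rightarrow> ereal" where
  "min_value f F = (INF z\<in>F. ereal (f z))"

definition mccormick :: "real^'n \<Rightarrow> real^'n \<Rightarrow> 'n \<Rightarrow> 'n \<Rightarrow> real^'n \<Rightarrow> real^'n^'n \<Rightarrow> real list" where
  "mccormick l u i j x Y =
    [ Y$i$j - u$j * x$i - l$i * x$j + u$j * l$i,
      Y$i$j - u$i * x$j - l$j * x$i + u$i * l$j,
      - Y$i$j + u$j * x$i + u$i * x$j - u$i * u$j,
      - Y$i$j + l$j * x$i + l$i * x$j - l$i * l$j ]"

definition triangle ::
  "real^'n \<Rightarrow> real^'n \<Rightarrow> 'n \<Rightarrow> 'n \<Rightarrow> 'n \<Rightarrow> real^'n \<Rightarrow> real^'n^'n \<Rightarrow> real list" where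
  "triangle l u i j k x Y =
    [ (l$k - u$k) * Y$i$j + (l$j - u$j) * Y$i$k - u$i * Y$j$k
        + u$i * u$k * x$j + (u$j * u$k - l$j * l$k) * x$i + u$i * u$j * x$k - u$i * u$j * u$k,
      (l$k - u$k) * Y$i$j - u$j * Y$i$k + (l$i - u$i) * Y$j$k
        + (u$i * u$k - l$i * l$k) * x$j + u$j * u$k * x$i + u$i * u$j * x$k - u$i * u$j * u$k,
      - u$k * Y$i$j + (l$j - u$j) * Y$i$k + (l$i - u$i) * Y$j$k
        + u$i * u$k * x$j + u$j * u$k * x$i + (u$i * u$j - l$i * l$j) * x$k - u$i * u$j * u$k,
      (u$j - l$j) * Y$i$k + (l$k - u$k) * Y$i$j + u$i * Y$j$k
        + (l$j * u$k - u$j * l$k) * x$i - u$i * l$k * x$j - u$i * u$j * x$k + u$i * u$j * l$k,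
      u$j * Y$i$k + (l$k - u$k) * Y$i$j + (u$i - l$i) * Y$j$k
        - u$j * l$k * x$i + (l$i * u$k - u$i * l$k) * x$j - u$i * u$j * x$k + u$i * u$j * l$k,
      (u$k - l$k) * Y$i$j + u$i * Y$j$k + (l$j - u$j) * Y$i$k
        - u$i * u$k * x$j + (u$j * l$k - l$j * u$k) * x$i - u$i * l$j * x$k + u$i * l$j * u$k,
      u$k * Y$i$j + (u$i - l$i) * Y$j$k + (l$j - u$j) * Y$i$k
        - u$i * u$k * x$j - l$j * u$k * x$i + (l$i * u$j - u$i * l$j) * x$k + u$i * l$j * u$k,
      (u$k - l$k) * Y$i$j + (l$i - u$i) * Y$j$k + u$j * Y$i$k
        + (u$i * l$k - l$i * u$k) * x$j - u$j * u$k * x$i - l$i * u$j * x$k + l$i * u$j * u$k,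
      u$k * Y$i$j + (l$i - u$i) * Y$j$k + (u$j - l$j) * Y$i$k
        - l$i * u$k * x$j - u$j * u$k * x$i + (u$i * l$j - l$i * u$j) * x$k + l$i * u$j * u$k,
      - u$i * Y$j$k + (u$j - l$j) * Y$i$k + (u$k - l$k) * Y$i$j
        + u$i * l$k * x$j + (l$j * l$k - u$j * u$k) * x$i + u$i * l$j * x$k - u$i * l$j * l$k,
      (u$i - l$i) * Y$j$k - u$j * Y$i$k + (u$k - l$k) * Y$i$j
        + (l$i * l$k - u$i * u$k) * x$j + u$j * l$k * x$i + l$i * u$j * x$k - l$i * u$j * l$k,
      - u$k * Y$i$j + (u$i - l$i) * Y$j$k + (u$j - l$j) * Y$i$k
        + l$i * u$k * x$j + l$j * u$k * x$i + (l$i * l$j - u$i * u$j) * x$k - l$i * l$j * u$k ]"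

(* Below, \<bullet> on matrices is the entrywise inner product.  The families Q, c (resp. b) matter
   only at the indices 0..m (resp. 1..m). *)

definition feasible_P ::
  "nat \<Rightarrow> (nat \<Rightarrow> 'n::finite rmat) \<Rightarrow> (nat \<Rightarrow> 'n rvec) \<Rightarrow> (nat \<Rightarrow> real) \<Rightarrow> 'n rvec \<Rightarrow> 'n rvec
    \<Rightarrow> 'n rvec set" where
  "feasible_P m Q c b l u = {x.
     (\<forall>r\<in>{1..m}. Q r \<bullet> outer x + c r \<bullet> x \<le> b r) \<and>
     (\<forall>i. l$i \<le> x$i \<and> x$i \<le> u$i)}"

definition feasible_P' ::
  "nat \<Rightarrow> (nat \<Rightarrow> 'n::{finite,linorder} rmat) \<Rightarrow> (nat \<Rightarrow> 'n rvec) \<Rightarrow> (nat \<Rightarrow> real)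
    \<Rightarrow> 'n rvec \<Rightarrow> 'n rvec \<Rightarrow> (nat \<Rightarrow> 'n rmat) \<Rightarrow> ('n rvec \<times> 'n rmat) set" where
  "feasible_P' m Q c b l u S = {(x, Y).
     (\<forall>i. l$i \<le> x$i \<and> x$i \<le> u$i) \<and>
     (\<forall>i j. i < j \<longrightarrow> Y$j$i = Y$i$j) \<and>
     (\<forall>r\<in>{1..m}. S r \<bullet> outer x + c r \<bullet> x + (Q r - S r) \<bullet> Y \<le> b r) \<and>
     (\<forall>i j. i \<le> j \<longrightarrow> (\<forall>h\<in>set (mccormick l u i j x Y). h \<le> 0)) \<and>
     (\<forall>i j k. i < j \<and> j < k \<longrightarrow> (\<forall>h\<in>set (triangle l u i j k x Y). h \<le> 0))}"

definition value_P' ::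
  "nat \<Rightarrow> (nat \<Rightarrow> 'n::{finite,linorder} rmat) \<Rightarrow> (nat \<Rightarrow> 'n rvec) \<Rightarrow> (nat \<Rightarrow> real)
    \<Rightarrow> 'n rvec \<Rightarrow> 'n rvec \<Rightarrow> (nat \<Rightarrow> 'n rmat) \<Rightarrow> ereal" where
  "value_P' m Q c b l u S =
     min_value (\<lambda>(x, Y). S 0 \<bullet> outer x + c 0 \<bullet> x + (Q 0 - S 0) \<bullet> Y)
       (feasible_P' m Q c b l u S)"

definition value_OPT ::
  "nat \<Rightarrow> (nat \<Rightarrow> 'n::{finite,linorder} rmat) \<Rightarrow> (nat \<Rightarrow> 'n rvec) \<Rightarrow> (nat \<Rightarrow> real)
    \<Rightarrow> 'n rvec \<Rightarrow> 'n rvec \<Rightarrow> ereal" where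
  "value_OPT m Q c b l u = (SUP S\<in>{S. \<forall>r\<le>m. psd (S r)}. value_P' m Q c b l u S)"

definition feasible_SDP ::
  "nat \<Rightarrow> (nat \<Rightarrow> 'n::{finite,linorder} rmat) \<Rightarrow> (nat \<Rightarrow> 'n rvec) \<Rightarrow> (nat \<Rightarrow> real)
    \<Rightarrow> 'n rvec \<Rightarrow> 'n rvec \<Rightarrow> ('n rvec \<times> 'n rmat) set" where
  "feasible_SDP m Q c b l u = {(x, X).
     transpose X = X \<and>
     (\<forall>r\<in>{1..m}. Q r \<bullet> X + c r \<bullet> x \<le> b r) \<and>
     (\<forall>i. X$i$i - u$i * x$i - l$i * x$i + u$i * l$i \<le> 0 \<and>
          - X$i$i + 2 * u$i * x$i - (u$i)\<^sup>2 \<le> 0 \<and>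
          - X$i$i + 2 * l$i * x$i - (l$i)\<^sup>2 \<le> 0) \<and>
     (\<forall>i j. i < j \<longrightarrow> (\<forall>h\<in>set (mccormick l u i j x X). h \<le> 0)) \<and>
     (\<forall>i j k. i < j \<and> j < k \<longrightarrow> (\<forall>h\<in>set (triangle l u i j k x X). h \<le> 0)) \<and>
     psd (bordered x X)}"

definition value_SDP ::
  "nat \<Rightarrow> (nat \<Rightarrow> 'n::{finite,linorder} rmat) \<Rightarrow> (nat \<Rightarrow> 'n rvec) \<Rightarrow> (nat \<Rightarrow> real)
    \<Rightarrow> 'n rvec \<Rightarrow> 'n rvec \<Rightarrow> ereal" where
  "value_SDP m Q c b l u =
     min_value (\<lambda>(x, X). Q 0 \<bullet> X + c 0 \<bullet> x) (feasible_SDP m Q c b l u)"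

end

theory Submission
  imports Defs
begin

text \<open>
  Both problems range over the same compact convex polytope \<open>K\<close> of pairs \<open>(x, Y)\<close>, cut out by the
  box, the symmetry of \<open>Y\<close>, and the McCormick and triangle inequalities (\<open>rlt_polytope\<close>). On \<open>K\<close>
  the semidefinite relaxation imposes the hard constraint \<open>Y \<succeq> x x\<^sup>T\<close>, by a Schur complement
  (\<open>psd_bordered_iff\<close>), whereas the quadratic relaxation adds to the objective and to every
  constraint the penalty \<open>\<langle>S\<^sub>r, x x\<^sup>T - Y\<rangle>\<close>.

  The inequality \<open>v(OPT) \<le> v(SDP)\<close> is weak duality: two positive semidefinite matrices have a
  nonnegative inner product (\<open>psd_inner_nonneg\<close>), so the penalties are \<open>\<le> 0\<close> at each point
  that is feasible for the semidefinite relaxation.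

  For the converse let \<open>\<alpha> < v(SDP)\<close> and treat "objective \<open>\<le> \<alpha>\<close>" as one more linear constraint.
  Then no point of \<open>K\<close> satisfies all the linear constraints together with \<open>Y \<succeq> x x\<^sup>T\<close>.
  The core of the proof (\<open>shor_penalty_exists\<close>) turns this into one matrix \<open>S \<succeq> 0\<close> such that at
  every point of \<open>K\<close> some penalised constraint fails strictly; taking \<open>S\<^sub>r = S\<close> for all \<open>r\<close> gives
  \<open>v(P') \<ge> \<alpha>\<close>. To find \<open>S\<close>, collect the pairs \<open>(a, M)\<close> such that for some point of \<open>K\<close>
  the number \<open>a\<close> bounds all linear constraint violations and \<open>M \<succeq> x x\<^sup>T - Y\<close>. This set is
  convex, it is closed because \<open>K\<close> is compact, and it omits the origin, so a hyperplane
  \<open>(\<mu>, T)\<close> strictly separates it from the origin, with \<open>\<mu> \<ge> 0\<close> and \<open>T \<succeq> 0\<close>.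
  If \<open>\<mu> > 0\<close>, then \<open>S = T / \<mu>\<close> works. The delicate case is \<open>\<mu> = 0\<close>, where the hyperplane says nothing
  about the linear constraints; but the separation is strict and \<open>K\<close> is bounded, so \<open>\<mu>\<close> can be
  replaced by \<open>\<mu> + \<epsilon>\<close> for a small \<open>\<epsilon> > 0\<close>.
  As \<open>S\<close> depends on \<open>\<alpha>\<close>, this yields \<open>v(OPT) \<ge> v(SDP)\<close> without exhibiting a maximiser.

  Aiming at the same \<open>S\<close> for every constraint is what lets the constraints enter through their
  maximum \<open>a\<close> alone, so that the separation takes place in \<open>\<real> \<times> \<real>\<^sup>n\<^sup>\<times>\<^sup>n\<close> whatever their number.
\<close>

section \<open>Positive semidefinite matrices and the Schur complement\<close>

text \<open>
  This makes quadratic forms linear in the matrix, so that the inner product calculus and the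
  continuity rules apply to them; the Loewner order is expressed through it from here on.
\<close>
lemma quadratic_form_eq_inner_outer: "v \<bullet> (A *v v) = A \<bullet> outer v" for A :: "real^'n^'n"
  by (simp add: inner_vec_def matrix_vector_mult_def outer_def sum_distrib_left mult_ac)

lemma inner_outer_outer: "outer x \<bullet> outer v = (v \<bullet> x)\<^sup>2" for v x :: "real^'n"
proof -
  have "outer x \<bullet> outer v = (\<Sum>i\<in>UNIV. \<Sum>j\<in>UNIV. (v$i * x$i) * (v$j * x$j))"
    by (simp add: inner_vec_def outer_def mult_ac)
  also have "\<dots> = (v \<bullet> x)\<^sup>2"
    by (simp add: inner_vec_def power2_eq_square sum_product)
  finally show ?thesis .
qed

lemma inner_transpose_transpose: "transpose A \<bullet> transpose B = A \<bullet> B" for A B :: "real^'n^'n"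
  unfolding inner_vec_def transpose_def by (simp, rule sum.swap)

lemma transpose_eq_self_iff: "transpose A = A \<longleftrightarrow> (\<forall>i j. A $ j $ i = A $ i $ j)"
  by (auto simp: transpose_def vec_eq_iff)

lemma transpose_outer: "transpose (outer v) = outer v"
  by (simp add: transpose_def outer_def vec_eq_iff mult.commute)

lemma psd_iff_inner_outer: "psd A \<longleftrightarrow> transpose A = A \<and> (\<forall>v. 0 \<le> A \<bullet> outer v)"
  by (simp add: psd_def quadratic_form_eq_inner_outer)

text \<open>
  The quadratic polynomial \<open>t \<mapsto> (v + t w)\<^sup>T A (v + t w)\<close> is nonnegative, so its discriminant is not
  positive.
\<close>
lemma psd_cauchy_schwarz:
  assumes "psd A"
  shows "(v \<bullet> (A *v w))\<^sup>2 \<le> (v \<bullet> (A *v v)) * (w \<bullet> (A *v w))"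
proof -
  define a b d where "a = v \<bullet> (A *v v)" and "b = v \<bullet> (A *v w)" and "d = w \<bullet> (A *v w)"
  have wv: "w \<bullet> (A *v v) = b"
    using assms by (metis b_def dot_lmul_matrix inner_commute psd_def transpose_matrix_vector)
  have quad: "0 \<le> a + 2 * t * b + t\<^sup>2 * d" for t
  proof -
    have "0 \<le> (v + t *\<^sub>R w) \<bullet> (A *v (v + t *\<^sub>R w))"
      using assms by (simp add: psd_def)
    also have "\<dots> = a + 2 * t * b + t\<^sup>2 * d"
      by (simp add: matrix_vector_right_distrib matrix_vector_mult_scaleR inner_add_left
          inner_add_right wv a_def[symmetric] b_def[symmetric] d_def[symmetric]
          power2_eq_square algebra_simps)
    finally show ?thesis .
  qed
  have "d \<ge> 0" using assms by (simp add: psd_def d_def)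
  have "b\<^sup>2 \<le> a * d"
  proof (cases "d = 0")
    case True
    \<comment> \<open>A nonconstant affine function takes the value \<open>-1\<close> somewhere.\<close>
    have "b = 0"
    proof (rule ccontr)
      assume "b \<noteq> 0"
      then show False
        using quad[of "- (a + 1) / (2 * b)"] True by (simp add: field_simps)
    qed
    then show ?thesis using True by simp
  next
    case False
    with \<open>d \<ge> 0\<close> have "d > 0" by simp
    \<comment> \<open>The minimum is attained at \<open>t = - b / d\<close>.\<close>
    have "0 \<le> a - b\<^sup>2 / d"
      using quad[of "- b / d"] \<open>d > 0\<close> by (simp add: power2_eq_square field_simps)
    then show ?thesis using \<open>d > 0\<close> by (simp add: field_simps)
  qed
  then show ?thesis by (simp add: a_def b_def d_def)
qed

lemma matrix_vector_mult_axis: "A *v axis k 1 = transpose A $ k" for A :: "real^'n^'n"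
  by (simp add: matrix_vector_mult_basis column_def transpose_def vec_eq_iff)

text \<open>
  A Cholesky-type elimination writes \<open>S\<close> as a sum of rank-one matrices \<open>w w\<^sup>T\<close>, for which the
  claim is the hypothesis on \<open>A\<close>. One step subtracts the multiple of \<open>S\<^sub>k S\<^sub>k\<^sup>T\<close>, for a nonzero row
  \<open>S\<^sub>k\<close>, that annihilates this row; the Cauchy--Schwarz inequality keeps the remainder positive
  semidefinite, and the number of nonzero rows decreases.
\<close>
lemma psd_inner_nonneg:
  fixes S A :: "real^'n^'n"
  assumes "psd S" and A: "\<And>v. 0 \<le> A \<bullet> outer v"
  shows "0 \<le> S \<bullet> A"
  using \<open>psd S\<close>
proof (induction "card {k. S $ k \<noteq> 0}" arbitrary: S rule: less_induct)
  case less
  show ?case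
  proof (cases "S = 0")
    case True
    then show ?thesis by simp
  next
    case False
    then obtain k where k: "S $ k \<noteq> 0" by (auto simp: vec_eq_iff)
    have Sk: "S *v axis k 1 = S $ k"
      using less.prems by (simp add: matrix_vector_mult_axis psd_def)
    have form_k: "axis k 1 \<bullet> (S *v axis k 1) = S $ k $ k"
      by (simp add: Sk inner_axis')
    have cs: "(v \<bullet> S $ k)\<^sup>2 \<le> (S \<bullet> outer v) * S $ k $ k" for v
      using psd_cauchy_schwarz[OF less.prems, of v "axis k 1"] unfolding form_k
      by (simp add: Sk quadratic_form_eq_inner_outer)
    \<comment> \<open>A zero diagonal entry would force the whole row to vanish.\<close>
    have "S $ k $ k \<noteq> 0"
      using cs[of "S $ k"] k by auto
    moreover have "0 \<le> S $ k $ k"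
      using less.prems form_k by (metis psd_def)
    ultimately have pos: "S $ k $ k > 0" by simp
    define R where "R = S - (1 / S $ k $ k) *\<^sub>R outer (S $ k)"
    have "psd R"
      unfolding psd_iff_inner_outer
    proof (intro conjI allI)
      show "transpose R = R"
        using less.prems by (simp add: R_def psd_def transpose_def outer_def vec_eq_iff mult.commute)
      show "0 \<le> R \<bullet> outer v" for v
        using cs[of v] pos by (simp add: R_def inner_diff_left inner_outer_outer field_simps)
    qed
    have sym: "S $ i $ j = S $ j $ i" for i j
      using less.prems by (simp add: psd_def transpose_eq_self_iff)
    have "R $ k = 0"
      using pos by (simp add: R_def outer_def vec_eq_iff)
    moreover have "R $ i = 0" if "S $ i = 0" for i
      using that sym[of k i] by (simp add: R_def outer_def vec_eq_iff)
    ultimately have "{i. R $ i \<noteq> 0} \<subset> {i. S $ i \<noteq> 0}"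
      using k by auto
    then have "0 \<le> R \<bullet> A"
      using \<open>psd R\<close> by (intro less.hyps psubset_card_mono) auto
    moreover have "S \<bullet> A = R \<bullet> A + (1 / S $ k $ k) * (A \<bullet> outer (S $ k))"
      by (simp add: R_def inner_diff_left inner_commute[of A])
    ultimately show ?thesis
      using pos A[of "S $ k"] by simp
  qed
qed

lemma bordered_quadratic_form:
  fixes x :: "real^'n" and X :: "real^'n^'n" and w :: "real^('n option)"
  defines "v \<equiv> \<chi> i. w $ Some i"
  shows "w \<bullet> (bordered x X *v w) = (w $ None)\<^sup>2 + 2 * w $ None * (v \<bullet> x) + X \<bullet> outer v"
proof -
  have sum_option: "(\<Sum>p\<in>UNIV. f p) = f None + (\<Sum>i\<in>UNIV. f (Some i))"
    for f :: "'n option \<Rightarrow> real"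
    by (simp add: UNIV_option_conv sum.reindex)
  show ?thesis
    unfolding quadratic_form_eq_inner_outer
    by (simp add: inner_vec_def outer_def bordered_def sum_option v_def power2_eq_square
        sum.distrib sum_distrib_left algebra_simps)
qed

text \<open>
  The form of the bordered matrix is \<open>t\<^sup>2 + 2 t (v\<^sup>T x) + v\<^sup>T X v\<close>. Minimising over the extra
  coordinate \<open>t\<close>, at \<open>t = - v\<^sup>T x\<close>, leaves \<open>v\<^sup>T X v - (v\<^sup>T x)\<^sup>2\<close>, the form of the Schur
  complement \<open>X - x x\<^sup>T\<close>.
\<close>
lemma psd_bordered_iff:
  fixes x :: "real^'n" and X :: "real^'n^'n"
  assumes "transpose X = X"
  shows "psd (bordered x X) \<longleftrightarrow> (\<forall>v. (v \<bullet> x)\<^sup>2 \<le> X \<bullet> outer v)"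
proof
  assume psd: "psd (bordered x X)"
  show "\<forall>v. (v \<bullet> x)\<^sup>2 \<le> X \<bullet> outer v"
  proof
    fix v
    define w :: "real^('n option)" where
      "w = (\<chi> p. case p of None \<Rightarrow> - (v \<bullet> x) | Some i \<Rightarrow> v $ i)"
    have w: "w $ None = - (v \<bullet> x)" "(\<chi> i. w $ Some i) = v"
      by (simp_all add: w_def vec_eq_iff)
    have "0 \<le> w \<bullet> (bordered x X *v w)"
      using psd by (simp add: psd_def)
    then show "(v \<bullet> x)\<^sup>2 \<le> X \<bullet> outer v"
      unfolding bordered_quadratic_form w by (simp add: power2_eq_square)
  qed
next
  assume *: "\<forall>v. (v \<bullet> x)\<^sup>2 \<le> X \<bullet> outer v"
  have "X $ i $ j = X $ j $ i" for i j
    using assms by (simp add: transpose_eq_self_iff)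
  then have "transpose (bordered x X) = bordered x X"
    by (simp add: transpose_def bordered_def vec_eq_iff split: option.split)
  moreover have "0 \<le> w \<bullet> (bordered x X *v w)" for w
  proof -
    define v where "v = (\<chi> i. w $ Some i)"
    have "0 \<le> (w $ None + v \<bullet> x)\<^sup>2" by simp
    also have "\<dots> \<le> (w $ None)\<^sup>2 + 2 * w $ None * (v \<bullet> x) + X \<bullet> outer v"
      using *[rule_format, of v] by (simp add: power2_sum)
    finally show ?thesis unfolding bordered_quadratic_form v_def .
  qed
  ultimately show "psd (bordered x X)" by (simp add: psd_def)
qed

section \<open>The polytope shared by the two relaxations\<close>

text \<open>
  The constraints common to both relaxations, which involve neither the \<open>Q r\<close> nor any
  semidefinite matrix.
\<close>
definition rlt_polytope ::
  "'n::{finite,linorder} rvec \<Rightarrow> 'n rvec \<Rightarrow> ('n rvec \<times> 'n rmat) set" where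
  "rlt_polytope l u = {(x, Y).
     (\<forall>i. l$i \<le> x$i \<and> x$i \<le> u$i) \<and>
     (\<forall>i j. i < j \<longrightarrow> Y$j$i = Y$i$j) \<and>
     (\<forall>i j. i \<le> j \<longrightarrow> (\<forall>h\<in>set (mccormick l u i j x Y). h \<le> 0)) \<and>
     (\<forall>i j k. i < j \<and> j < k \<longrightarrow> (\<forall>h\<in>set (triangle l u i j k x Y). h \<le> 0))}"

lemma rlt_polytope_symmetric:
  assumes "(x, Y) \<in> rlt_polytope l u"
  shows "transpose Y = Y"
proof -
  have "Y $ j $ i = Y $ i $ j" if "i < j" for i j
    using assms that by (simp add: rlt_polytope_def)
  then have "Y $ j $ i = Y $ i $ j" for i j
    by (metis linorder_cases)
  then show ?thesis by (simp add: transpose_def vec_eq_iff)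
qed

text \<open>
  Every McCormick and triangle function is affine in \<open>(x, Y)\<close>, so its list of values at a convex
  combination is the entrywise convex combination of the two lists of values.
\<close>
lemma convex_rlt_polytope:
  fixes l u :: "'n::{finite,linorder} rvec"
  shows "convex (rlt_polytope l u)"
proof (rule convexI)
  fix z z' :: "'n rvec \<times> 'n rmat" and s t :: real
  assume z: "z \<in> rlt_polytope l u" "z' \<in> rlt_polytope l u"
    and st: "0 \<le> s" "0 \<le> t" "s + t = 1"
  obtain x Y x' Y' where zz: "z = (x, Y)" "z' = (x', Y')" by (cases z; cases z')
  \<comment> \<open>Eliminating \<open>s\<close> lets the constant terms of the affine functions cancel as ring identities.\<close>
  have s: "s = 1 - t" using st by simp
  have map2: "\<forall>h\<in>set (map2 (\<lambda>p q. s * p + t * q) ps qs). h \<le> 0"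
    if "\<forall>h\<in>set ps. h \<le> 0" "\<forall>h\<in>set qs. h \<le> 0" for ps qs :: "real list"
  proof
    fix h assume "h \<in> set (map2 (\<lambda>p q. s * p + t * q) ps qs)"
    then obtain p q where "p \<in> set ps" "q \<in> set qs" and h: "h = s * p + t * q"
      by (auto dest: set_zip_leftD set_zip_rightD)
    then have "p \<le> 0" "q \<le> 0" using that by auto
    then show "h \<le> 0"
      using st by (simp add: h add_nonpos_nonpos mult_nonneg_nonpos)
  qed
  have mc: "mccormick l u i j (s *\<^sub>R x + t *\<^sub>R x') (s *\<^sub>R Y + t *\<^sub>R Y') =
      map2 (\<lambda>p q. s * p + t * q) (mccormick l u i j x Y) (mccormick l u i j x' Y')" for i j
    unfolding s by (simp add: mccormick_def algebra_simps)
  have tr: "triangle l u i j k (s *\<^sub>R x + t *\<^sub>R x') (s *\<^sub>R Y + t *\<^sub>R Y') =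
      map2 (\<lambda>p q. s * p + t * q) (triangle l u i j k x Y) (triangle l u i j k x' Y')" for i j k
    unfolding s by (simp add: triangle_def algebra_simps)
  have "(s *\<^sub>R x + t *\<^sub>R x', s *\<^sub>R Y + t *\<^sub>R Y') \<in> rlt_polytope l u"
    unfolding rlt_polytope_def mem_Collect_eq prod.case
  proof (intro conjI allI impI)
    fix i
    have "x $ i \<in> {l $ i..u $ i}" "x' $ i \<in> {l $ i..u $ i}"
      using z by (auto simp: rlt_polytope_def zz)
    then have "s *\<^sub>R x $ i + t *\<^sub>R x' $ i \<in> {l $ i..u $ i}"
      using st by (intro convexD convex_real_interval) auto
    then show "l $ i \<le> (s *\<^sub>R x + t *\<^sub>R x') $ i" "(s *\<^sub>R x + t *\<^sub>R x') $ i \<le> u $ i"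
      by simp_all
  next
    show "(s *\<^sub>R Y + t *\<^sub>R Y') $ j $ i = (s *\<^sub>R Y + t *\<^sub>R Y') $ i $ j" if "i < j" for i j
      using z that by (simp add: rlt_polytope_def zz)
    show "\<forall>h\<in>set (mccormick l u i j (s *\<^sub>R x + t *\<^sub>R x') (s *\<^sub>R Y + t *\<^sub>R Y')). h \<le> 0"
      if "i \<le> j" for i j
      unfolding mc using z that by (intro map2) (simp_all add: rlt_polytope_def zz)
    show "\<forall>h\<in>set (triangle l u i j k (s *\<^sub>R x + t *\<^sub>R x') (s *\<^sub>R Y + t *\<^sub>R Y')). h \<le> 0"
      if "i < j \<and> j < k" for i j k
      unfolding tr using z that by (intro map2) (simp_all add: rlt_polytope_def zz)
  qed
  then show "s *\<^sub>R z + t *\<^sub>R z' \<in> rlt_polytope l u"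
    by (simp add: zz)
qed

text \<open>
  The first and the last McCormick inequality confine \<open>Y\<^sub>i\<^sub>j\<close> to \<open>[0, u\<^sub>i u\<^sub>j]\<close> once \<open>x\<close> lies in
  the nonnegative box.
\<close>
lemma compact_rlt_polytope:
  assumes "\<And>p. 0 \<le> l $ p"
  shows "compact (rlt_polytope l u)"
proof -
  have "closed (rlt_polytope l u)"
    unfolding rlt_polytope_def case_prod_unfold mccormick_def triangle_def list.set ball_simps
      imp_conjL all_conj_distrib
    by (simp, intro closed_Collect_conj closed_Collect_all closed_Collect_imp open_Collect_const
        closed_Collect_le closed_Collect_eq continuous_intros)
  moreover have "rlt_polytope l u \<subseteq> cbox l u \<times> cbox 0 (outer u)"
  proof
    fix z assume z: "z \<in> rlt_polytope l u"
    obtain x Y where zz: "z = (x, Y)" by (cases z)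
    have x: "l $ i \<le> x $ i" "x $ i \<le> u $ i" for i
      using z by (auto simp: rlt_polytope_def zz)
    have *: "0 \<le> Y $ i $ j \<and> Y $ i $ j \<le> u $ i * u $ j" if "i \<le> j" for i j
    proof -
      have h: "Y$i$j - u$j * x$i - l$i * x$j + u$j * l$i \<le> 0"
          "- Y$i$j + l$j * x$i + l$i * x$j - l$i * l$j \<le> 0"
        using z that by (auto simp: rlt_polytope_def zz mccormick_def)
      have "u$j * x$i \<le> u$j * u$i" "l$i * x$j \<le> l$i * u$j" "0 \<le> l$j * x$i" "l$i * l$j \<le> l$i * x$j"
        using x assms by (meson mult_left_mono mult_nonneg_nonneg order_trans)+
      then show ?thesis using h by (simp add: mult.commute)
    qed
    have "Y $ i $ j = Y $ j $ i" for i j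
      using rlt_polytope_symmetric[of x Y] z by (simp add: zz transpose_eq_self_iff)
    then have "0 \<le> Y $ i $ j \<and> Y $ i $ j \<le> u $ i * u $ j" for i j
      using * by (metis linear mult.commute)
    then show "z \<in> cbox l u \<times> cbox 0 (outer u)"
      using x by (auto simp: zz mem_box_cart(2)[of x] mem_box(2)[of Y] Basis_vec_def inner_axis outer_def)
  qed
  ultimately show ?thesis
    using bounded_subset[OF bounded_Times[OF bounded_cbox bounded_cbox]]
    by (auto simp: compact_eq_bounded_closed)
qed

section \<open>A single exact penalty matrix\<close>

text \<open>
  A theorem of the alternative: if \<open>Y \<succeq> x x\<^sup>T\<close> is incompatible with finitely many linear
  constraints on \<open>K\<close>, then one penalty matrix certifies this at all points of \<open>K\<close> at once.
  Compactness of \<open>K\<close> takes the place of a constraint qualification: it makes the separated set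
  closed, and it leaves room to perturb the multiplier of the linear constraints away from \<open>0\<close>.
\<close>
lemma shor_penalty_exists:
  fixes K :: "('n::finite rvec \<times> 'n rmat) set"
    and Q :: "nat \<Rightarrow> 'n rmat" and c :: "nat \<Rightarrow> 'n rvec" and \<beta> :: "nat \<Rightarrow> real"
  assumes K: "compact K" "convex K"
    and infeasible: "\<And>x Y. (x, Y) \<in> K \<Longrightarrow> \<forall>r\<le>m. Q r \<bullet> Y + c r \<bullet> x \<le> \<beta> r
        \<Longrightarrow> \<exists>v. Y \<bullet> outer v < (v \<bullet> x)\<^sup>2"
  obtains S where "psd S"
    and "\<And>x Y. (x, Y) \<in> K \<Longrightarrow> \<exists>r\<le>m. \<beta> r < Q r \<bullet> Y + c r \<bullet> x + S \<bullet> (outer x - Y)"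
proof (cases "K = {}")
  case True
  then show ?thesis
    using that[of 0] by (simp add: psd_iff_inner_outer transpose_def vec_eq_iff)
next
  case False
  then obtain x0 Y0 where z0: "(x0, Y0) \<in> K" by auto
  \<comment> \<open>\<open>C\<close> is the projection of the closed convex set \<open>D\<close> along the compact set \<open>K\<close>.
    The matrix \<open>M\<close> ranges over all square matrices and is compared by quadratic forms only, which
    later forces the matrix part of the normal vector to be symmetric.\<close>
  define D where "D = {(z, y). (\<forall>r\<le>m. Q r \<bullet> snd z + c r \<bullet> fst z - \<beta> r \<le> fst y) \<and>
      (\<forall>v. (v \<bullet> fst z)\<^sup>2 \<le> (snd y + snd z) \<bullet> outer v)}"
  define C where "C = {y. \<exists>z. z \<in> K \<and> (z, y) \<in> D}"
  have C_I: "(a, M) \<in> C" if "(x, Y) \<in> K" "\<And>r. r \<le> m \<Longrightarrow> Q r \<bullet> Y + c r \<bullet> x - \<beta> r \<le> a"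
      "\<And>v. (v \<bullet> x)\<^sup>2 \<le> (M + Y) \<bullet> outer v" for x Y a M
    using that by (force simp: C_def D_def)
  have "closed D"
    unfolding D_def case_prod_unfold
    by (intro closed_Collect_conj closed_Collect_all closed_Collect_imp open_Collect_const
        closed_Collect_le continuous_intros)
  then have "closed C"
    unfolding C_def by (rule closed_compact_projection[OF K(1)])
  moreover have "convex C"
  proof -
    have "convex D"
    proof (rule convexI)
      fix p p' :: "('n rvec \<times> 'n rmat) \<times> (real \<times> 'n rmat)" and s t :: real
      assume p: "p \<in> D" "p' \<in> D" and st: "0 \<le> s" "0 \<le> t" "s + t = 1"
      obtain x Y a M x' Y' a' M' where pp: "p = ((x, Y), (a, M))" "p' = ((x', Y'), (a', M'))"
        by (metis surj_pair)
      have "Q r \<bullet> (s *\<^sub>R Y + t *\<^sub>R Y') + c r \<bullet> (s *\<^sub>R x + t *\<^sub>R x') - \<beta> r \<le> s * a + t * a'"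
        if "r \<le> m" for r
      proof -
        have "s * (Q r \<bullet> Y + c r \<bullet> x - \<beta> r) + t * (Q r \<bullet> Y' + c r \<bullet> x' - \<beta> r) \<le> s * a + t * a'"
          using p that st by (intro add_mono mult_left_mono) (auto simp: D_def pp)
        moreover have "s * \<beta> r + t * \<beta> r = \<beta> r"
          using st by (metis distrib_right mult_1)
        ultimately show ?thesis
          by (simp add: inner_add_right algebra_simps)
      qed
      moreover have "(v \<bullet> (s *\<^sub>R x + t *\<^sub>R x'))\<^sup>2
          \<le> ((s *\<^sub>R M + t *\<^sub>R M') + (s *\<^sub>R Y + t *\<^sub>R Y')) \<bullet> outer v" for v
      proof -
        have "(s * (v \<bullet> x) + t * (v \<bullet> x'))\<^sup>2 \<le> s * (v \<bullet> x)\<^sup>2 + t * (v \<bullet> x')\<^sup>2"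
          using convex_power2 st by (auto simp: convex_on_def)
        also have "\<dots> \<le> s * ((M + Y) \<bullet> outer v) + t * ((M' + Y') \<bullet> outer v)"
          using p st by (intro add_mono mult_left_mono) (auto simp: D_def pp)
        finally show ?thesis
          by (simp add: inner_add_left inner_add_right algebra_simps)
      qed
      ultimately show "s *\<^sub>R p + t *\<^sub>R p' \<in> D"
        by (simp add: D_def pp)
    qed
    then have "convex (snd ` (D \<inter> (K \<times> UNIV)))"
      using K(2) by (intro convex_linear_image linear_snd convex_Int convex_Times convex_UNIV)
    moreover have "C = snd ` (D \<inter> (K \<times> UNIV))"
      by (force simp: C_def)
    ultimately show ?thesis by simp
  qed
  moreover have "(0, 0) \<notin> C"
    using infeasible by (fastforce simp: C_def D_def not_le[symmetric])
  ultimately obtain y \<delta> where "y \<bullet> (0, 0) < \<delta>" and sep: "\<forall>p\<in>C. \<delta> < y \<bullet> p"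
    using separating_hyperplane_closed_point[of C "(0, 0)"] by blast
  then have "\<delta> > 0" by (cases y) simp
  obtain \<mu> T where y: "y = (\<mu>, T)" by (cases y)
  have sep: "\<delta> < \<mu> * a + T \<bullet> M" if "(a, M) \<in> C" for a M
    using sep that by (force simp: y)
  have "bdd_above ((\<lambda>r. Q r \<bullet> Y0 + c r \<bullet> x0 - \<beta> r) ` {..m})"
    by (rule bdd_above_finite) simp
  then obtain a0 where a0: "\<And>r. r \<le> m \<Longrightarrow> Q r \<bullet> Y0 + c r \<bullet> x0 - \<beta> r \<le> a0"
    by (auto simp: bdd_above_def)
  \<comment> \<open>\<open>C\<close> recedes in the direction \<open>(1, 0)\<close> and in every direction \<open>(0, A)\<close> with
    \<open>v\<^sup>T A v \<ge> 0\<close>; a functional bounded below on \<open>C\<close> is nonnegative on these directions.\<close>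
  have ray: "(a0 + s, outer x0 - Y0 + t *\<^sub>R A) \<in> C"
    if "0 \<le> s" "0 \<le> t" "\<And>v. 0 \<le> A \<bullet> outer v" for s t A
  proof (rule C_I[OF z0])
    show "Q r \<bullet> Y0 + c r \<bullet> x0 - \<beta> r \<le> a0 + s" if "r \<le> m" for r
      using a0[OF that] \<open>0 \<le> s\<close> by simp
    show "(v \<bullet> x0)\<^sup>2 \<le> (outer x0 - Y0 + t *\<^sub>R A + Y0) \<bullet> outer v" for v
      using that by (simp add: inner_add_left inner_outer_outer)
  qed
  have ray_nonneg: "0 \<le> k" if "\<And>t. 0 \<le> t \<Longrightarrow> \<delta> < d + t * k" for k d :: real
  proof (rule ccontr)
    assume "\<not> 0 \<le> k"
    then have "0 \<le> \<bar>d\<bar> / - k" "(\<bar>d\<bar> / - k) * k = - \<bar>d\<bar>"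
      by (simp_all add: divide_nonneg_neg)
    then show False
      using that[of "\<bar>d\<bar> / - k"] \<open>\<delta> > 0\<close> by linarith
  qed
  have "0 \<le> \<mu>"
  proof (rule ray_nonneg)
    show "\<delta> < (\<mu> * a0 + T \<bullet> (outer x0 - Y0)) + t * \<mu>" if "0 \<le> t" for t
      using sep[OF ray[of t 0 0]] that by (simp add: algebra_simps)
  qed
  have T_nonneg: "0 \<le> T \<bullet> A" if "\<And>v. 0 \<le> A \<bullet> outer v" for A
  proof (rule ray_nonneg)
    show "\<delta> < (\<mu> * a0 + T \<bullet> (outer x0 - Y0)) + t * (T \<bullet> A)" if "0 \<le> t" for t
      using sep[OF ray[of 0 t A]] that \<open>\<And>v. 0 \<le> A \<bullet> outer v\<close> by (simp add: inner_add_right)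
  qed
  have "psd T"
    unfolding psd_iff_inner_outer
  proof (intro conjI allI)
    show "0 \<le> T \<bullet> outer v" for v
      by (rule T_nonneg) (simp add: inner_outer_outer)
    \<comment> \<open>The quadratic form of a skew matrix vanishes, so \<open>A = T\<^sup>T - T\<close> is an admissible direction;
      since \<open>2 \<langle>T, T\<^sup>T - T\<rangle> = - \<parallel>T\<^sup>T - T\<parallel>\<^sup>2\<close>, this forces \<open>T\<close> to be symmetric.\<close>
    have "0 \<le> T \<bullet> (transpose T - T)"
    proof (rule T_nonneg)
      fix v show "0 \<le> (transpose T - T) \<bullet> outer v"
        using inner_transpose_transpose[of T "outer v"]
        by (simp add: inner_diff_left transpose_outer)
    qed
    then have "(transpose T - T) \<bullet> (transpose T - T) \<le> 0"
      using inner_transpose_transpose[of T T]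
      by (simp add: inner_diff_left inner_diff_right inner_commute)
    then have "transpose T - T = 0"
      by (metis inner_eq_zero_iff inner_ge_zero order_antisym)
    then show "transpose T = T" by simp
  qed
  \<comment> \<open>On \<open>K\<close> the bound \<open>a\<close> is at least the constraint of index 0, hence at least \<open>- B\<close>. Raising
    the multiplier by \<open>\<epsilon> = \<delta> / B\<close> therefore costs at most \<open>\<delta>\<close>, the gap of the separation.\<close>
  obtain B where B: "B > 0" "\<And>x Y. (x, Y) \<in> K \<Longrightarrow> - B \<le> Q 0 \<bullet> Y + c 0 \<bullet> x - \<beta> 0"
  proof -
    have "compact ((\<lambda>(x, Y). Q 0 \<bullet> Y + c 0 \<bullet> x - \<beta> 0) ` K)"
      unfolding case_prod_unfold
      by (intro compact_continuous_image continuous_intros K(1))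
    then obtain B where "B > 0" "\<forall>z\<in>(\<lambda>(x, Y). Q 0 \<bullet> Y + c 0 \<bullet> x - \<beta> 0) ` K. norm z \<le> B"
      using compact_imp_bounded bounded_pos by metis
    then show ?thesis by (intro that[of B]) fastforce+
  qed
  define \<epsilon> where "\<epsilon> = \<delta> / B"
  have "\<epsilon> > 0" using \<open>\<delta> > 0\<close> B by (simp add: \<epsilon>_def)
  define S where "S = (1 / (\<mu> + \<epsilon>)) *\<^sub>R T"
  have T: "T = (\<mu> + \<epsilon>) *\<^sub>R S" using \<open>0 \<le> \<mu>\<close> \<open>\<epsilon> > 0\<close> by (simp add: S_def)
  show thesis
  proof (rule that)
    show "psd S"
      using \<open>psd T\<close> \<open>0 \<le> \<mu>\<close> \<open>\<epsilon> > 0\<close>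
      by (simp add: psd_iff_inner_outer S_def transpose_def vec_eq_iff)
  next
    fix x Y assume z: "(x, Y) \<in> K"
    show "\<exists>r\<le>m. \<beta> r < Q r \<bullet> Y + c r \<bullet> x + S \<bullet> (outer x - Y)"
    proof (rule ccontr)
      \<comment> \<open>If all penalised constraints held, this \<open>a\<close> would bound all the violations, and the
        point \<open>(a, x x\<^sup>T - Y)\<close> of \<open>C\<close> would lie on the hyperplane \<open>(\<mu> + \<epsilon>) a + \<langle>T, M\<rangle> = 0\<close>.\<close>
      define a where "a = - (S \<bullet> (outer x - Y))"
      assume "\<not> ?thesis"
      then have a: "Q r \<bullet> Y + c r \<bullet> x - \<beta> r \<le> a" if "r \<le> m" for r
        using that by (force simp: a_def not_less)
      have "(a, outer x - Y) \<in> C"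
        by (rule C_I[OF z a]) (simp_all add: inner_outer_outer)
      then have "\<delta> < \<mu> * a - (\<mu> + \<epsilon>) * a"
        using sep by (fastforce simp: T a_def)
      also have "\<dots> = \<epsilon> * - a" by (simp add: algebra_simps)
      also have "\<dots> \<le> \<epsilon> * B"
        using a[of 0] B(2)[OF z] \<open>\<epsilon> > 0\<close> by (intro mult_left_mono) auto
      finally show False using B by (simp add: \<epsilon>_def)
    qed
  qed
qed

section \<open>Comparison of the optimal values\<close>

lemma feasible_P'_iff:
  "(x, Y) \<in> feasible_P' m Q c b l u S \<longleftrightarrow> (x, Y) \<in> rlt_polytope l u \<and>
     (\<forall>r\<in>{1..m}. Q r \<bullet> Y + c r \<bullet> x + S r \<bullet> (outer x - Y) \<le> b r)"
  unfolding feasible_P'_def rlt_polytope_def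
  by (auto simp: inner_diff_left inner_diff_right algebra_simps)

text \<open>
  The semidefinite relaxation does not list the box among its constraints, but it implies it:
  \<open>x\<^sub>i\<^sup>2 \<le> X\<^sub>i\<^sub>i\<close> and the diagonal McCormick inequality give \<open>(x\<^sub>i - l\<^sub>i) (x\<^sub>i - u\<^sub>i) \<le> 0\<close>. On the
  diagonal the first two McCormick inequalities coincide, which is why three are listed there.
\<close>
lemma feasible_SDP_iff:
  assumes lu: "\<And>p. l $ p \<le> u $ p"
  shows "(x, X) \<in> feasible_SDP m Q c b l u \<longleftrightarrow> (x, X) \<in> rlt_polytope l u \<and>
     (\<forall>r\<in>{1..m}. Q r \<bullet> X + c r \<bullet> x \<le> b r) \<and> (\<forall>v. (v \<bullet> x)\<^sup>2 \<le> X \<bullet> outer v)"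
    (is "?L \<longleftrightarrow> ?R")
proof
  assume L: ?L
  then have sym: "transpose X = X" by (simp add: feasible_SDP_def)
  then have shor: "(v \<bullet> x)\<^sup>2 \<le> X \<bullet> outer v" for v
    using L psd_bordered_iff by (auto simp: feasible_SDP_def)
  have diag: "X$i$i - u$i * x$i - l$i * x$i + u$i * l$i \<le> 0"
      "- X$i$i + 2 * u$i * x$i - (u$i)\<^sup>2 \<le> 0" "- X$i$i + 2 * l$i * x$i - (l$i)\<^sup>2 \<le> 0" for i
    using L by (auto simp: feasible_SDP_def)
  have box: "l $ i \<le> x $ i \<and> x $ i \<le> u $ i" for i
  proof -
    have "(x $ i)\<^sup>2 \<le> X $ i $ i"
      using shor[of "axis i 1"] quadratic_form_eq_inner_outer[of "axis i 1" X] sym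
      by (simp add: matrix_vector_mult_axis inner_axis')
    then have "(x $ i - l $ i) * (x $ i - u $ i) \<le> 0"
      using diag(1)[of i] by (simp add: power2_eq_square algebra_simps)
    then show ?thesis
      using lu[of i] by (auto simp: mult_le_0_iff)
  qed
  have "\<forall>h\<in>set (mccormick l u i j x X). h \<le> 0" if "i \<le> j" for i j
  proof (cases "i = j")
    case True
    then show ?thesis
      using diag[of i] by (simp add: mccormick_def power2_eq_square algebra_simps)
  next
    case False
    then have "i < j" using that by simp
    then show ?thesis using L by (simp add: feasible_SDP_def)
  qed
  moreover have "X $ j $ i = X $ i $ j" for i j
    using sym by (simp add: transpose_eq_self_iff)
  ultimately show ?R
    using L box shor by (simp add: feasible_SDP_def rlt_polytope_def)
next
  assume R: ?R
  then have sym: "transpose X = X" by (blast intro: rlt_polytope_symmetric)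
  then have "psd (bordered x X)" using R psd_bordered_iff by blast
  moreover have "X$i$i - u$i * x$i - l$i * x$i + u$i * l$i \<le> 0 \<and>
      - X$i$i + 2 * u$i * x$i - (u$i)\<^sup>2 \<le> 0 \<and> - X$i$i + 2 * l$i * x$i - (l$i)\<^sup>2 \<le> 0" for i
  proof -
    have "\<forall>h\<in>set (mccormick l u i i x X). h \<le> 0"
      using R unfolding rlt_polytope_def by blast
    then show ?thesis by (simp add: mccormick_def power2_eq_square)
  qed
  moreover have "\<forall>i j. i < j \<longrightarrow> (\<forall>h\<in>set (mccormick l u i j x X). h \<le> 0)"
    using R unfolding rlt_polytope_def by (blast intro: less_imp_le)
  ultimately show ?L
    using R sym by (simp add: feasible_SDP_def rlt_polytope_def)
qed

text \<open>
  The penalties are nonpositive where \<open>X \<succeq> x x\<^sup>T\<close>, so each point that is feasible for the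
  semidefinite relaxation stays feasible with no larger an objective value.
\<close>
lemma value_P'_le_value_SDP:
  assumes lu: "\<And>p. l $ p \<le> u $ p" and S: "\<And>r. r \<le> m \<Longrightarrow> psd (S r)"
  shows "value_P' m Q c b l u S \<le> value_SDP m Q c b l u"
  unfolding value_SDP_def min_value_def
proof (rule INF_greatest, clarify)
  fix x X assume "(x, X) \<in> feasible_SDP m Q c b l u"
  then have z: "(x, X) \<in> rlt_polytope l u" "\<forall>r\<in>{1..m}. Q r \<bullet> X + c r \<bullet> x \<le> b r"
    and shor: "\<And>v. (v \<bullet> x)\<^sup>2 \<le> X \<bullet> outer v"
    using feasible_SDP_iff[OF lu] by blast+
  have penalty: "S r \<bullet> (outer x - X) \<le> 0" if "r \<le> m" for r
    using psd_inner_nonneg[OF S[OF that], of "X - outer x"] shor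
    by (simp add: inner_diff_left inner_diff_right inner_outer_outer)
  have "(x, X) \<in> feasible_P' m Q c b l u S"
    unfolding feasible_P'_iff using z penalty by fastforce
  then have "value_P' m Q c b l u S \<le> ereal (S 0 \<bullet> outer x + c 0 \<bullet> x + (Q 0 - S 0) \<bullet> X)"
    unfolding value_P'_def min_value_def by (rule INF_lower2) simp
  also have "\<dots> \<le> ereal (Q 0 \<bullet> X + c 0 \<bullet> x)"
    using penalty[of 0] by (simp add: inner_diff_left inner_diff_right)
  finally show "value_P' m Q c b l u S \<le> ereal (Q 0 \<bullet> X + c 0 \<bullet> x)" .
qed

text \<open>
  The penalty lemma applies with the objective as the constraint of index 0 and right-hand side \<open>\<alpha>\<close>.
  At a point feasible for the quadratic relaxation the violated penalised constraint can only
  be this one, so the penalised objective exceeds \<open>\<alpha>\<close>. This covers an infeasible semidefinite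
  relaxation as well, where \<open>\<alpha>\<close> is arbitrary.
\<close>
lemma value_P'_ge_if_less_value_SDP:
  assumes lu: "\<And>p. 0 \<le> l $ p \<and> l $ p \<le> u $ p"
    and \<alpha>: "ereal \<alpha> < value_SDP m Q c b l u"
  obtains S where "psd S" and "ereal \<alpha> \<le> value_P' m Q c b l u (\<lambda>_. S)"
proof -
  define \<beta> where "\<beta> = b(0 := \<alpha>)"
  have \<beta>: "\<beta> r = (if r = 0 then \<alpha> else b r)" for r by (simp add: \<beta>_def)
  have "\<exists>v. Y \<bullet> outer v < (v \<bullet> x)\<^sup>2"
    if "(x, Y) \<in> rlt_polytope l u" "\<forall>r\<le>m. Q r \<bullet> Y + c r \<bullet> x \<le> \<beta> r" for x Y
  proof (rule ccontr)
    assume "\<not> ?thesis"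
    moreover have "\<forall>r\<in>{1..m}. Q r \<bullet> Y + c r \<bullet> x \<le> b r"
      using that(2) by (auto simp: \<beta> split: if_splits)
    ultimately have "(x, Y) \<in> feasible_SDP m Q c b l u"
      using that(1) lu by (subst feasible_SDP_iff) (auto simp: not_less)
    then have "value_SDP m Q c b l u \<le> ereal (Q 0 \<bullet> Y + c 0 \<bullet> x)"
      unfolding value_SDP_def min_value_def by (rule INF_lower2) simp
    also have "\<dots> \<le> ereal \<alpha>" using that(2) by (auto simp: \<beta>)
    finally show False using \<alpha> by simp
  qed
  then obtain S where "psd S" and S: "\<And>x Y. (x, Y) \<in> rlt_polytope l u
      \<Longrightarrow> \<exists>r\<le>m. \<beta> r < Q r \<bullet> Y + c r \<bullet> x + S \<bullet> (outer x - Y)"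
    using shor_penalty_exists[OF compact_rlt_polytope convex_rlt_polytope] lu by metis
  have "ereal \<alpha> \<le> value_P' m Q c b l u (\<lambda>_. S)"
    unfolding value_P'_def min_value_def
  proof (rule INF_greatest, clarify)
    fix x Y assume "(x, Y) \<in> feasible_P' m Q c b l u (\<lambda>_. S)"
    then have z: "(x, Y) \<in> rlt_polytope l u"
      and con: "\<forall>r\<in>{1..m}. Q r \<bullet> Y + c r \<bullet> x + S \<bullet> (outer x - Y) \<le> b r"
      unfolding feasible_P'_iff by blast+
    obtain r where "r \<le> m" and r: "\<beta> r < Q r \<bullet> Y + c r \<bullet> x + S \<bullet> (outer x - Y)"
      using S[OF z] by blast
    have "r = 0"
    proof (rule ccontr)
      assume "r \<noteq> 0"
      then show False using con[rule_format, of r] \<open>r \<le> m\<close> r by (simp add: \<beta>)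
    qed
    then show "ereal \<alpha> \<le> ereal (S \<bullet> outer x + c 0 \<bullet> x + (Q 0 - S) \<bullet> Y)"
      using r by (simp add: \<beta> inner_diff_left inner_diff_right)
  qed
  with \<open>psd S\<close> show thesis by (rule that)
qed

theorem theorem1:
  fixes m :: nat
    and Q :: "nat \<Rightarrow> 'n::{finite,linorder} rmat"
    and c :: "nat \<Rightarrow> 'n rvec"
    and b :: "nat \<Rightarrow> real"
    and l u :: "'n rvec"
  assumes "\<And>r. r \<le> m \<Longrightarrow> transpose (Q r) = Q r"
    and "\<And>p. 0 \<le> l $ p \<and> l $ p \<le> u $ p"
    and "feasible_P m Q c b l u \<noteq> {}"
  shows "value_OPT m Q c b l u = value_SDP m Q c b l u"
proof (rule antisym)
  show "value_OPT m Q c b l u \<le> value_SDP m Q c b l u"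
    unfolding value_OPT_def using assms(2) by (auto intro!: SUP_least value_P'_le_value_SDP)
  show "value_SDP m Q c b l u \<le> value_OPT m Q c b l u"
  proof (rule ccontr)
    assume "\<not> ?thesis"
    then obtain \<alpha> where \<alpha>: "value_OPT m Q c b l u < ereal \<alpha>" "ereal \<alpha> < value_SDP m Q c b l u"
      using ereal_dense2 not_le by metis
    then obtain S where "psd S" "ereal \<alpha> \<le> value_P' m Q c b l u (\<lambda>_. S)"
      using value_P'_ge_if_less_value_SDP assms(2) by blast
    then have "ereal \<alpha> \<le> value_OPT m Q c b l u"
      unfolding value_OPT_def by (intro SUP_upper2[of "\<lambda>_. S"]) auto
    then show False using \<alpha>(1) by simp
  qed
qed

end
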